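(* Let $B$ be a translation invariant differentiation basis in $\mathbb{R}^2$. Then every $R_B$-set $E\subset\Gamma_2$ is a set of type $G_\delta$ in $\Gamma_2$.
   Context: A differentiation basis in $\mathbb{R}^n$ is a mapping $B$ assigning to each $x\in\mathbb{R}^n$ a family $B(x)$ of bounded measurable sets of positive Lebesgue measure containing $x$, such that there is a sequence $R_k\in B(x)$ with $\operatorname{diam}R_k\to 0$. $B$ is translation invariant if $B(x)=\{x+R: R\in B(0)\}$ for every $x$. For $f\in L(\mathbb{R}^n)$ the upper and lower derivatives of $\int f$ at $x$ with respect to $B$ are $\overline{D}_B(\int f,x)=\limsup_{R\in B(x),\,\operatorname{diam}R\to0}\frac{1}{|R|}\int_R f$ and $\underline{D}_B(\int f,x)=\liminf_{R\in B(x),\,\operatorname{diam}R\to0}\frac{1}{|R|}\int_R f$; $B$ differentiates $\int f$ if both equal $f(x)$ for almost every $x$. $F_B$ denotes the class of $f\in L(\mathbb{R}^n)$ whose integrals are differentiated by $B$. $\Gamma_2$ is the set of rotations of $\mathbb{R}^2$ about the origin, identified with the unit circle $\mathbb{T}$ (a rotation by angle $\theta$ corresponds to $e^{i\theta}$), with the distance between two rotations being the length of the shorter arc of $\mathbb{T}$ between the corresponding points; the topology on $\Gamma_2$ is that of this metric. For $\gamma\in\Gamma_2$ the $\gamma$-rotated basis is $B(\gamma)(x)=\{x+\gamma(R-x): R\in B(x)\}$. A set $E\subset\Gamma_2$ is an $R_B$-set if there exists $f\in L(\mathbb{R}^2)$ such that (1) for every $\gamma\in E$, $\overline{D}_{B(\gamma)}(\int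 f,x)=\infty$ for almost every $x\in\mathbb{R}^2$, and (2) $f\in F_{B(\gamma)}$ for every $\gamma\notin E$. *)

theory Defs
  imports "HOL-Analysis.Analysis" "HOL-Library.Liminf_Limsup"
begin

text \<open>We identify the plane R^2 with the complex numbers; Lebesgue measure is lebesgue on complex.\<close>

definition diff_basis :: "(complex \<Rightarrow> complex set set) \<Rightarrow> bool" where
  "diff_basis B \<longleftrightarrow>
     (\<forall>x. \<forall>R\<in>B x. bounded R \<and> R \<in> sets lebesgue \<and> emeasure lebesgue R > 0 \<and> x \<in> R) \<and>
     (\<forall>x. \<exists>Rk :: nat \<Rightarrow> complex set. (\<forall>k. Rk k \<in> B x) \<and> (\<lambda>k. diameter (Rk k)) \<longlonglongrightarrow> 0)"

definition transl_inv :: "(complex \<Rightarrow> complex set set) \<Rightarrow> bool" where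
  "transl_inv B \<longleftrightarrow> (\<forall>x. B x = (\<lambda>R. (\<lambda>y. x + y) ` R) ` B 0)"

definition basis_filter :: "(complex \<Rightarrow> complex set set) \<Rightarrow> complex \<Rightarrow> complex set filter" where
  "basis_filter B x = (INF e\<in>{0<..}. principal {R \<in> B x. diameter R < e})"

definition average :: "(complex \<Rightarrow> real) \<Rightarrow> complex set \<Rightarrow> real" where
  "average f R = (LINT y:R|lebesgue. f y) / measure lebesgue R"

definition upper_deriv :: "(complex \<Rightarrow> complex set set) \<Rightarrow> (complex \<Rightarrow> real) \<Rightarrow> complex \<Rightarrow> ereal" where
  "upper_deriv B f x = Limsup (basis_filter B x) (\<lambda>R. ereal (average f R))"

definition lower_deriv :: "(complex \<Rightarrow> complex set set) \<Rightarrow> (complex \<Rightarrow> real) \<Rightarrow> complex \<Rightarrow> ereal" where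
  "lower_deriv B f x = Liminf (basis_filter B x) (\<lambda>R. ereal (average f R))"

definition F_class :: "(complex \<Rightarrow> complex set set) \<Rightarrow> (complex \<Rightarrow> real) set" where
  "F_class B = {f. integrable lebesgue f \<and>
     (AE x in lebesgue. upper_deriv B f x = ereal (f x) \<and> lower_deriv B f x = ereal (f x))}"

text \<open>Gamma_2: rotations identified with unit complex numbers; gamma acts by multiplication.\<close>
definition Gamma2 :: "complex set" where
  "Gamma2 = {z. norm z = 1}"

definition arcdist :: "complex \<Rightarrow> complex \<Rightarrow> real" where
  "arcdist a b = \<bar>Arg (a / b)\<bar>"

definition rot_basis :: "(complex \<Rightarrow> complex set set) \<Rightarrow> complex \<Rightarrow> complex \<Rightarrow> complex set set" where
  "rot_basis B \<gamma> x = (\<lambda>R. (\<lambda>y. x + \<gamma> * (y - x)) ` R) ` B x"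

definition R_B_set :: "(complex \<Rightarrow> complex set set) \<Rightarrow> complex set \<Rightarrow> bool" where
  "R_B_set B E \<longleftrightarrow> E \<subseteq> Gamma2 \<and>
     (\<exists>f. integrable lebesgue f \<and>
        (\<forall>\<gamma>\<in>E. AE x in lebesgue. upper_deriv (rot_basis B \<gamma>) f x = \<infinity>) \<and>
        (\<forall>\<gamma>\<in>Gamma2 - E. f \<in> F_class (rot_basis B \<gamma>)))"

end

theory Submission
  imports Defs
begin

text \<open>For a rotation \<open>\<gamma>\<close> let \<open>W\<^sub>k(\<gamma>)\<close> be the set of points \<open>x\<close> at which some \<open>x + \<gamma>R\<close>
  with \<open>R \<in> B(0)\<close> and diameter below \<open>1/(k+1)\<close> carries an average of \<open>f\<close> exceeding \<open>k\<close>.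
  The upper derivative is infinite exactly on \<open>\<Inter>\<^sub>k W\<^sub>k(\<gamma>)\<close>. Averages over \<open>x + \<gamma>R\<close> depend
  continuously on \<open>(\<gamma>, x)\<close>, so \<open>W\<^sub>k(\<gamma>)\<close> is open and, for the unit disc \<open>D\<close>, the number
  \<open>|W\<^sub>k(\<gamma>) \<inter> D|\<close> is lower semicontinuous in \<open>\<gamma>\<close>. Hence \<open>G\<^sub>k = {\<gamma>. |W\<^sub>k(\<gamma>) \<inter> D| > |D|/2}\<close>
  is open. It contains \<open>E\<close>; and for \<open>\<gamma>\<close> outside \<open>E\<close> the decreasing sets \<open>W\<^sub>k(\<gamma>)\<close> have a null
  intersection, so \<open>\<gamma>\<close> leaves some \<open>G\<^sub>k\<close>. Thus \<open>E = \<Inter>\<^sub>k G\<^sub>k\<close>.\<close>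

section \<open>Invariance of plane Lebesgue measure under rigid motions\<close>

text \<open>Values on boxes determine the measure, and the coordinate identification pulls a box
  back to a box with the same side lengths.\<close>

lemma lborel_distr_Complex:
  "distr lborel borel (\<lambda>v::real^2. Complex (v $ 1) (v $ 2)) = lborel"
proof (rule lborel_eqI[symmetric])
  have [measurable]: "(\<lambda>v::real^2. Complex (v $ 1) (v $ 2)) \<in> borel_measurable borel"
    unfolding Complex_eq by (intro borel_measurable_continuous_onI continuous_intros)
  fix l u :: complex
  assume le: "\<And>b. b \<in> Basis \<Longrightarrow> l \<bullet> b \<le> u \<bullet> b"
  have le': "Re l \<le> Re u" "Im l \<le> Im u"
    using le[of 1] le[of \<i>] by (auto simp: Basis_complex_def)
  have B: "(Basis :: (real^2) set) = {axis 1 1, axis 2 1}"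
      by (auto simp: Basis_vec_def UNIV_2)
  let ?l = "vector [Re l, Im l] :: real^2" and ?u = "vector [Re u, Im u] :: real^2"
  have "(\<lambda>v::real^2. Complex (v $ 1) (v $ 2)) -` box l u = box ?l ?u"
    by (auto simp: box_def Basis_complex_def Basis_vec_def inner_axis forall_2)
  then have "emeasure (distr lborel borel (\<lambda>v::real^2. Complex (v $ 1) (v $ 2))) (box l u)
      = emeasure lborel (box ?l ?u)"
    by (simp add: emeasure_distr)
  also have "\<dots> = (\<Prod>b\<in>Basis. (?u - ?l) \<bullet> b)"
    using le' by (intro emeasure_lborel_box)
      (auto simp: B inner_axis)
  also have "(\<Prod>b\<in>Basis. (?u - ?l) \<bullet> b) = (Re u - Re l) * (Im u - Im l)"
    unfolding B by (simp add: axis_eq_axis inner_axis)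
  also have "\<dots> = (\<Prod>b\<in>Basis. (u - l) \<bullet> b)"
    by (simp add: Basis_complex_def)
  finally show "emeasure (distr lborel borel (\<lambda>v::real^2. Complex (v $ 1) (v $ 2))) (box l u)
      = (\<Prod>b\<in>Basis. (u - l) \<bullet> b)" .
qed simp

text \<open>In the coordinates of \<open>real^2\<close>, the preimage of a box under the rotation is
  the image of a box under an orthogonal map, and orthogonal maps of \<open>real^2\<close> preserve
  measure.\<close>

lemma lborel_distr_rotation:
  fixes c :: complex
  assumes c: "norm c = 1"
  shows "distr lborel borel ((*) c) = lborel"
proof (rule lborel_eqI[symmetric])
  define \<phi> :: "real^2 \<Rightarrow> complex" where "\<phi> v = Complex (v $ 1) (v $ 2)" for v
  define \<psi> :: "complex \<Rightarrow> real^2" where "\<psi> z = vector [Re z, Im z]" for z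
  have [measurable]: "\<phi> \<in> borel_measurable borel"
    unfolding \<phi>_def Complex_eq by (intro borel_measurable_continuous_onI continuous_intros)
  have \<phi>\<psi> [simp]: "\<phi> (\<psi> z) = z" for z by (simp add: \<phi>_def \<psi>_def)
  have \<psi>\<phi> [simp]: "\<psi> (\<phi> v) = v" for v by (simp add: \<phi>_def \<psi>_def vec_eq_iff forall_2)
  have distr\<phi>: "distr lborel borel \<phi> = lborel"
    using lborel_distr_Complex by (simp add: \<phi>_def[abs_def])
  have norm\<phi>: "norm (\<phi> v) = norm v" for v
    by (simp add: \<phi>_def norm_vec_def L2_set_def sum_2 cmod_def)
  \<comment> \<open>On the unit circle \<open>cnj c\<close> is the inverse of \<open>c\<close>, so
    images under \<open>f\<close> are preimages under multiplication by \<open>c\<close>.\<close>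
  define f where "f v = \<psi> (cnj c * \<phi> v)" for v
  have cc: "cnj c * c = 1" using c by (simp add: complex_norm_square[symmetric] mult.commute)
  have cc': "c * (cnj c * z) = z" for z
    using cc by (metis mult.commute mult.left_commute mult.right_neutral)
  have lin: "linear f"
    by (rule linearI) (auto simp: f_def \<phi>_def \<psi>_def vec_eq_iff forall_2 algebra_simps)
  have f: "orthogonal_transformation f"
    unfolding orthogonal_transformation using lin c
    by (simp add: f_def norm\<phi>[symmetric] norm_mult)
  fix l u :: complex
  assume le: "\<And>b. b \<in> Basis \<Longrightarrow> l \<bullet> b \<le> u \<bullet> b"
  have T: "\<phi> -` box l u \<in> sets borel" 
    by (rule measurable_sets_borel[where M=borel]) auto
  have em: "emeasure lborel (\<phi> -` S) = emeasure lborel S" if "S \<in> sets borel" for S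
    using that emeasure_distr[of \<phi> lborel borel S] by (simp add: distr\<phi>)
  have eq: "\<phi> -` ((*) c -` box l u) = f ` (\<phi> -` box l u)"
  proof (intro set_eqI iffI)
    fix v assume "v \<in> \<phi> -` ((*) c -` box l u)"
    then have "\<psi> (c * \<phi> v) \<in> \<phi> -` box l u" "v = f (\<psi> (c * \<phi> v))"
      using cc by (auto simp: f_def mult.assoc[symmetric])
    then show "v \<in> f ` (\<phi> -` box l u)" by blast
  next
    fix v assume "v \<in> f ` (\<phi> -` box l u)"
    then show "v \<in> \<phi> -` ((*) c -` box l u)"
      by (auto simp: f_def cc')
  qed
  have meas: "(*) c -` box l u \<in> sets borel"
    by (rule measurable_sets_borel[where M=borel]) auto
  have fin: "\<phi> -` box l u \<in> lmeasurable"
    using em[of "box l u"] T by (intro fmeasurableI) (auto simp: emeasure_lborel_box_eq)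
  have "emeasure (distr lborel borel ((*) c)) (box l u) = emeasure lborel ((*) c -` box l u)"
    by (simp add: emeasure_distr)
  also have "\<dots> = emeasure lborel (f ` (\<phi> -` box l u))"
    using em[OF meas] eq by simp
  \<comment> \<open>The facts on orthogonal images speak of \<open>lebesgue\<close>; the sets here
    are Borel, so both measures agree on them.\<close>
  also have "\<dots> = emeasure lebesgue (f ` (\<phi> -` box l u))"
    using measurable_sets_borel[OF \<open>\<phi> \<in> borel_measurable borel\<close> meas] eq by simp
  also have "\<dots> = emeasure lebesgue (\<phi> -` box l u)"
    using measurable_orthogonal_image[OF f fin] measure_orthogonal_image[OF f fin] fin
    by (simp add: emeasure_eq_measure2)
  also have "\<dots> = emeasure lborel (box l u)"
    using em[of "box l u"] T by simp
  also have "\<dots> = (\<Prod>b\<in>Basis. (u - l) \<bullet> b)" using le by (rule emeasure_lborel_box)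
  finally show "emeasure (distr lborel borel ((*) c)) (box l u) = (\<Prod>b\<in>Basis. (u - l) \<bullet> b)" .
qed simp

text \<open>A rigid motion is a rotation followed by a translation, and both preserve
  \<open>lborel\<close>. Passing to the completion in the target requires that null sets pull back
  to null sets, which the preserved measure guarantees.\<close>

lemma lebesgue_distr_rigid_motion:
  fixes c x :: complex
  assumes c: "norm c = 1"
  shows "(\<lambda>u. x + c * u) \<in> lebesgue \<rightarrow>\<^sub>M lebesgue"
    and "distr lebesgue lebesgue (\<lambda>u. x + c * u) = lebesgue"
proof -
  let ?T = "\<lambda>u. x + c * u"
  have [measurable]: "?T \<in> borel_measurable lebesgue" "?T \<in> borel_measurable lborel"
    by (auto intro!: measurable_completion)
  have "distr lborel borel ?T = distr (distr lborel borel ((*) c)) borel ((+) x)"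
    by (subst distr_distr) (auto simp: comp_def)
  also have "\<dots> = lborel"
    by (simp add: lborel_distr_rotation[OF c] lborel_distr_plus)
  finally have 1: "distr lborel lborel ?T = lborel"
    by (simp cong: distr_cong)
  then have 2: "distr lebesgue lborel ?T = lborel"
    by (subst distr_completion) auto
  show "?T \<in> lebesgue \<rightarrow>\<^sub>M lebesgue"
    by (intro completion.measurable_completion2) (auto simp: 2)
  show "distr lebesgue lebesgue ?T = lebesgue"
    using completion.completion_distr_eq[of ?T lborel lborel] by (simp add: 2)
qed

lemma integral_rigid_motion:
  fixes c x :: complex and f :: "complex \<Rightarrow> 'a::{banach, second_countable_topology}"
  assumes c: "norm c = 1" and f: "integrable lebesgue f"
  shows "integrable lebesgue (\<lambda>u. f (x + c * u))"
    and "(LINT u|lebesgue. f (x + c * u)) = (LINT u|lebesgue. f u)"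
proof -
  note T = lebesgue_distr_rigid_motion[OF c, of x]
  show "integrable lebesgue (\<lambda>u. f (x + c * u))"
    using f T by (subst (asm) T(2)[symmetric], subst (asm) integrable_distr_eq) auto
  show "(LINT u|lebesgue. f (x + c * u)) = (LINT u|lebesgue. f u)"
    using f T by (subst (2) T(2)[symmetric], subst integral_distr) auto
qed

section \<open>Approximation in the L1 norm by bounded continuous functions\<close>

text \<open>Induction over integrable functions reduces the claim to indicators, where a Urysohn
  function serves. Boundedness is included because it later gives a constant majorant on sets of
  finite measure.\<close>

lemma integrable_lebesgue_approx_continuous:
  fixes f :: "'a::euclidean_space \<Rightarrow> real"
  assumes "integrable lebesgue f" "0 < e"
  shows "\<exists>g. continuous_on UNIV g \<and> bounded (range g) \<and> integrable lebesgue g \<and>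
    (LINT x|lebesgue. norm (f x - g x)) < e"
  using assms
proof (induction arbitrary: e rule: integrable_induct)
  case (base A c)
  \<comment> \<open>The indicator is approximated up to \<open>2 * \<delta>\<close> and then scaled
    by \<open>c\<close>; the summand 1 covers \<open>c = 0\<close> and keeps the final inequality
    strict.\<close>
  define \<delta> where "\<delta> = e / (2 * (\<bar>c\<bar> + 1))"
  have \<delta>: "\<delta> > 0" using base by (simp add: \<delta>_def)
  obtain U where U: "open U" "A \<subseteq> U" "U - A \<in> lmeasurable" "emeasure lebesgue (U - A) < ennreal \<delta>"
    using sets_lebesgue_outer_open[OF base(1) \<delta>] .
  obtain K where K: "closed K" "K \<subseteq> A" "A - K \<in> lmeasurable" "emeasure lebesgue (A - K) < ennreal \<delta>"
    using sets_lebesgue_inner_closed[OF base(1) \<delta>] .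
  have A: "A \<in> lmeasurable" using base by (simp add: fmeasurable_def)
  obtain g :: "'a \<Rightarrow> real" where g: "continuous_on UNIV g" "\<And>x. g x \<in> closed_segment 1 0"
      "\<And>x. x \<in> K \<Longrightarrow> g x = 1" "\<And>x. x \<in> - U \<Longrightarrow> g x = 0"
    using Urysohn[of K "- U" "1::real" 0] U K by (auto simp: open_closed)
  have g01: "0 \<le> g x" "g x \<le> 1" for x
    using g(2)[of x] by (auto simp: closed_segment_eq_real_ivl)
  \<comment> \<open>\<open>g\<close> is 1 on \<open>K\<close> and 0 off \<open>U\<close>, so it
    differs from the indicator only on \<open>U - K\<close>, and there by at most 1.\<close>
  have diff: "norm (indicator A x - g x) \<le> indicator (U - A) x + indicator (A - K) x" for x
    using g01[of x] g(3,4)[of x] U K by (auto simp: indicator_def)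
  have int: "integrable lebesgue (\<lambda>x. indicator (U - A) x + indicator (A - K) x :: real)"
    using U K by (intro Bochner_Integration.integrable_add) (auto simp: fmeasurable_def)
  have gm [measurable]: "g \<in> borel_measurable lebesgue"
    using borel_measurable_continuous_onI[OF g(1)] by (intro measurable_completion) simp
  have [measurable]: "A \<in> sets lebesgue" by fact
  have intd: "integrable lebesgue (\<lambda>x. indicator A x - g x)"
    by (rule Bochner_Integration.integrable_bound[OF int]) (use diff in \<open>auto intro!: AE_I2 order_trans[OF diff]\<close>)
  have intA: "integrable lebesgue (indicator A :: 'a \<Rightarrow> real)"
    using A by (simp add: fmeasurable_def)
  have intg: "integrable lebesgue g"
    using Bochner_Integration.integrable_diff[OF intA intd] by simp
  have "(LINT x|lebesgue. norm (indicator A x - g x)) \<le>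
      (LINT x|lebesgue. indicator (U - A) x + indicator (A - K) x)"
    using int intd diff by (intro integral_mono) auto
  also have "\<dots> = measure lebesgue (U - A) + measure lebesgue (A - K)"
    using U K by (subst Bochner_Integration.integral_add) (auto simp: fmeasurable_def)
  also have "\<dots> < \<delta> + \<delta>"
    using U K \<delta> by (intro add_strict_mono) (auto simp: emeasure_eq_measure2 ennreal_less_iff)
  finally have less: "(LINT x|lebesgue. norm (indicator A x - g x)) < 2 * \<delta>" by simp
  have "(LINT x|lebesgue. norm (indicator A x *\<^sub>R c - c * g x)) =
      (LINT x|lebesgue. \<bar>c\<bar> * norm (indicator A x - g x))"
  proof (intro Bochner_Integration.integral_cong refl)
    fix x
    have "indicator A x *\<^sub>R c - c * g x = c * (indicator A x - g x)" by (simp add: algebra_simps)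
    then show "norm (indicator A x *\<^sub>R c - c * g x) = \<bar>c\<bar> * norm (indicator A x - g x)"
      by (simp add: abs_mult)
  qed
  also have "\<dots> = \<bar>c\<bar> * (LINT x|lebesgue. norm (indicator A x - g x))" by simp
  also have "\<dots> \<le> \<bar>c\<bar> * (2 * \<delta>)" using less by (intro mult_left_mono) auto
  also have "\<dots> < e" using base(3) by (simp add: \<delta>_def field_simps)
  finally show ?case
    using g(1) intg g01
    by (intro exI[of _ "\<lambda>x. c * g x"])
       (auto intro!: continuous_intros boundedI[of _ "\<bar>c\<bar>"] simp: abs_mult mult_left_le)
next
  case (add f1 f2)
  from add.IH(1)[of "e/2"] add.IH(2)[of "e/2"] add.prems obtain g1 g2
    where g: "continuous_on UNIV g1" "bounded (range g1)" "integrable lebesgue g1"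
         "(LINT x|lebesgue. norm (f1 x - g1 x)) < e/2"
         "continuous_on UNIV g2" "bounded (range g2)" "integrable lebesgue g2"
         "(LINT x|lebesgue. norm (f2 x - g2 x)) < e/2" by auto
  have "(LINT x|lebesgue. norm (f1 x + f2 x - (g1 x + g2 x))) \<le>
      (LINT x|lebesgue. norm (f1 x - g1 x) + norm (f2 x - g2 x))"
    using add g by (intro integral_mono Bochner_Integration.integrable_add integrable_norm
          Bochner_Integration.integrable_diff) auto
  also have "\<dots> < e"
    using add g by (subst Bochner_Integration.integral_add) auto
  finally show ?case
    using g by (intro exI[of _ "\<lambda>x. g1 x + g2 x"]) (auto intro!: continuous_intros bounded_plus_comp)
next
  case (lim f s)
  \<comment> \<open>The induction supplies \<open>s i\<close> converging pointwise with norm at most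
    \<open>2 * norm (f x)\<close>; this gives the majorant with factor 3.\<close>
  have "(\<lambda>i. LINT x|lebesgue. norm (f x - s i x)) \<longlonglongrightarrow> (LINT x::'a|lebesgue. 0)"
  proof (rule integral_dominated_convergence[where w="\<lambda>x. 3 * norm (f x)"])
    show "AE x in lebesgue. (\<lambda>i. norm (f x - s i x)) \<longlonglongrightarrow> 0"
    proof (rule AE_I2)
      fix x :: 'a
      have "(\<lambda>i. norm (f x - s i x)) \<longlonglongrightarrow> norm (f x - f x)"
        using lim.hyps(2)[of x] by (intro tendsto_intros) auto
      then show "(\<lambda>i. norm (f x - s i x)) \<longlonglongrightarrow> 0" by simp
    qed
    show "AE x in lebesgue. norm (norm (f x - s i x)) \<le> 3 * norm (f x)" for i
    proof (rule AE_I2)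
      fix x :: 'a
      show "norm (norm (f x - s i x)) \<le> 3 * norm (f x)"
        using lim.hyps(3)[of x i] norm_triangle_ineq4[of "f x" "s i x"] by auto
    qed
  qed (use lim in auto)
  then have "(\<lambda>i. LINT x|lebesgue. norm (f x - s i x)) \<longlonglongrightarrow> 0" by simp
  then have "\<forall>\<^sub>F i in sequentially. (LINT x|lebesgue. norm (f x - s i x)) < e/2"
    using lim.prems by (intro order_tendstoD(2)) auto
  then obtain i where i: "(LINT x|lebesgue. norm (f x - s i x)) < e/2"
    unfolding eventually_sequentially by blast
  obtain g where g: "continuous_on UNIV g" "bounded (range g)" "integrable lebesgue g"
         "(LINT x|lebesgue. norm (s i x - g x)) < e/2"
    using lim.IH[of "e/2" i] lim.prems by auto
  have "(LINT x|lebesgue. norm (f x - g x)) \<le>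
      (LINT x|lebesgue. norm (f x - s i x) + norm (s i x - g x))"
    using lim g by (intro integral_mono Bochner_Integration.integrable_add integrable_norm
          Bochner_Integration.integrable_diff) auto
  also have "\<dots> < e"
    using lim g i by (subst Bochner_Integration.integral_add) auto
  finally show ?case using g by blast
qed

section \<open>Integrals over rigidly moved sets and their continuity\<close>

text \<open>The image is the preimage under the inverse motion, which is again rigid and hence
  measurable.\<close>

lemma rigid_image_sets_lebesgue:
  fixes c x :: complex
  assumes c: "norm c = 1" and R: "R \<in> sets lebesgue"
  shows "(\<lambda>u. x + c * u) ` R \<in> sets lebesgue"
proof -
  have c0: "c \<noteq> 0" using c by auto
  have "(\<lambda>u. x + c * u) ` R = (\<lambda>u. - (x / c) + inverse c * u) -` R \<inter> space lebesgue"
  proof (intro set_eqI iffI)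
    fix y assume "y \<in> (\<lambda>u. - (x / c) + inverse c * u) -` R \<inter> space lebesgue"
    then have "- (x / c) + inverse c * y \<in> R" by simp
    moreover have "y = x + c * (- (x / c) + inverse c * y)" using c0 by (simp add: field_simps)
    ultimately show "y \<in> (\<lambda>u. x + c * u) ` R" by blast
  qed (use c0 in \<open>auto simp: field_simps\<close>)
  moreover have "(\<lambda>u. - (x / c) + inverse c * u) \<in> lebesgue \<rightarrow>\<^sub>M lebesgue"
    using c by (intro lebesgue_distr_rigid_motion) (simp add: norm_inverse)
  ultimately show ?thesis using R measurable_sets by metis
qed

lemma set_integral_rigid_image:
  fixes c x :: complex and f :: "complex \<Rightarrow> real"
  assumes c: "norm c = 1" and R: "R \<in> sets lebesgue" and f: "integrable lebesgue f"
  shows "(LINT y:(\<lambda>u. x + c * u) ` R|lebesgue. f y) = (LINT u:R|lebesgue. f (x + c * u))"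
proof -
  let ?S = "(\<lambda>u. x + c * u) ` R"
  have c0: "c \<noteq> 0" using c by auto
  have "integrable lebesgue (\<lambda>y. indicator ?S y *\<^sub>R f y)"
    using rigid_image_sets_lebesgue[OF c R] f by (intro integrable_mult_indicator)
  from integral_rigid_motion(2)[OF c this, of x]
  have "(LINT y:?S|lebesgue. f y) = (LINT u|lebesgue. indicator ?S (x + c * u) *\<^sub>R f (x + c * u))"
    by (simp add: set_lebesgue_integral_def)
  moreover have "indicator ?S (x + c * u) = (indicator R u :: real)" for u
    using c0 by (auto simp: indicator_def)
  ultimately show ?thesis by (simp add: set_lebesgue_integral_def)
qed

lemma measure_rigid_image:
  fixes c x :: complex
  assumes c: "norm c = 1" and R: "R \<in> lmeasurable"
  shows "measure lebesgue ((\<lambda>u. x + c * u) ` R) = measure lebesgue R"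
proof -
  let ?S = "(\<lambda>u. x + c * u) ` R"
  have c0: "c \<noteq> 0" using c by auto
  have T: "(\<lambda>u. x + c * u) \<in> lebesgue \<rightarrow>\<^sub>M lebesgue"
    by (rule lebesgue_distr_rigid_motion[OF c])
  have "measure lebesgue ?S = measure (distr lebesgue lebesgue (\<lambda>u. x + c * u)) ?S"
    by (simp add: lebesgue_distr_rigid_motion(2)[OF c])
  also have "\<dots> = measure lebesgue ((\<lambda>u. x + c * u) -` ?S \<inter> space lebesgue)"
    using R by (intro measure_distr T rigid_image_sets_lebesgue[OF c]) auto
  also have "(\<lambda>u. x + c * u) -` ?S \<inter> space lebesgue = R"
    using c0 by auto
  finally show ?thesis .
qed

text \<open>Replacing \<open>f\<close> by a nearby continuous \<open>g\<close> costs the same L1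
  error for every rigid motion, since motions preserve measure. For \<open>g\<close> itself
  dominated convergence on \<open>R\<close> applies. The three errors are each below
  \<open>e/3\<close>.\<close>

lemma tendsto_set_integral_rigid_motion:
  fixes c :: "nat \<Rightarrow> complex" and f :: "complex \<Rightarrow> real"
  assumes c: "\<And>n. norm (c n) = 1" "c \<longlonglongrightarrow> c0" and x: "x \<longlonglongrightarrow> x0"
    and f: "integrable lebesgue f" and R: "R \<in> lmeasurable"
  shows "(\<lambda>n. LINT u:R|lebesgue. f (x n + c n * u)) \<longlonglongrightarrow> (LINT u:R|lebesgue. f (x0 + c0 * u))"
proof (rule LIMSEQ_I)
  fix e :: real assume e: "e > 0"
  have c0: "norm c0 = 1"
    using tendsto_norm[OF c(2)] c(1) by (simp add: LIMSEQ_const_iff)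
  obtain g where g: "continuous_on UNIV g" "bounded (range g)" "integrable lebesgue g"
         "(LINT x|lebesgue. norm (f x - g x)) < e/3"
    using integrable_lebesgue_approx_continuous[OF f, of "e/3"] e by auto
  obtain b where b: "\<And>u. norm (g u) \<le> b" using g(2) by (auto simp: bounded_iff)
  have Rs [measurable]: "R \<in> sets lebesgue" using R by auto
  have close: "norm ((LINT u:R|lebesgue. f (y + d * u)) - (LINT u:R|lebesgue. g (y + d * u))) < e/3"
    if d: "norm d = 1" for y d
  proof -
    have i: "integrable lebesgue (\<lambda>u. f (y + d * u))" "integrable lebesgue (\<lambda>u. g (y + d * u))"
      using integral_rigid_motion(1)[OF d] f g by auto
    have fg: "integrable lebesgue (\<lambda>u. norm (f u - g u))" using f g by auto
    have "integrable lebesgue (\<lambda>u. indicator R u *\<^sub>R f (y + d * u))"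
      "integrable lebesgue (\<lambda>u. indicator R u *\<^sub>R g (y + d * u))"
      by (rule integrable_mult_indicator[OF Rs] i)+
    then have "(LINT u:R|lebesgue. f (y + d * u)) - (LINT u:R|lebesgue. g (y + d * u)) =
        (LINT u|lebesgue. indicator R u *\<^sub>R (f (y + d * u) - g (y + d * u)))"
      unfolding set_lebesgue_integral_def scaleR_diff_right by (simp only: Bochner_Integration.integral_diff)
    also have "norm \<dots> \<le> (LINT u|lebesgue. norm (f (y + d * u) - g (y + d * u)))"
      using i by (intro order_trans[OF integral_norm_bound] integral_mono integrable_norm
          integrable_mult_indicator[OF Rs]) (auto simp: indicator_def)
    also have "\<dots> = (LINT x|lebesgue. norm (f x - g x))"
      using integral_rigid_motion(2)[OF d fg] .
    finally show ?thesis using g(4) by simp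
  qed
  have gm: "(\<lambda>u. g (y + d * u)) \<in> borel_measurable lebesgue" for y d
    using g(1) by (intro measurable_completion)
      (auto intro!: borel_measurable_continuous_onI continuous_intros continuous_on_compose2[OF g(1)])
  have "(\<lambda>n. LINT u:R|lebesgue. g (x n + c n * u)) \<longlonglongrightarrow> (LINT u:R|lebesgue. g (x0 + c0 * u))"
    unfolding set_lebesgue_integral_def
  proof (rule integral_dominated_convergence[where w="\<lambda>u. indicator R u * b"])
    show "integrable lebesgue (\<lambda>u. indicator R u * b)"
      using R by (intro integrable_mult_left) (auto simp: fmeasurable_def)
    show "AE u in lebesgue. (\<lambda>n. indicat_real R u *\<^sub>R g (x n + c n * u)) \<longlonglongrightarrow>
        indicat_real R u *\<^sub>R g (x0 + c0 * u)"
      by (intro AE_I2 tendsto_intros continuous_on_tendsto_compose[OF g(1)] c x) auto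
    show "AE u in lebesgue. norm (indicat_real R u *\<^sub>R g (x n + c n * u)) \<le> indicator R u * b" for n
      using b by (intro AE_I2) (auto simp: indicator_def)
  qed (use gm in auto)
  from LIMSEQ_D[OF this, of "e/3"] e obtain N where N: "\<And>n. n \<ge> N \<Longrightarrow>
      norm ((LINT u:R|lebesgue. g (x n + c n * u)) - (LINT u:R|lebesgue. g (x0 + c0 * u))) < e/3"
    by (metis zero_less_divide_iff zero_less_numeral)
  have "norm ((LINT u:R|lebesgue. f (x n + c n * u)) - (LINT u:R|lebesgue. f (x0 + c0 * u))) < e"
    if "n \<ge> N" for n
    using N[OF that] close[OF c(1)[of n], of "x n"] close[OF c0, of x0]
    unfolding real_norm_def by linarith
  then show "\<exists>N. \<forall>n\<ge>N. norm ((LINT u:R|lebesgue. f (x n + c n * u)) -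
      (LINT u:R|lebesgue. f (x0 + c0 * u))) < e" by blast
qed

section \<open>Infinite upper derivatives as countable intersections\<close>

text \<open>The principal filters form a directed family, by taking the minimum of two bounds, so a
  single \<open>e\<close> suffices.\<close>

lemma eventually_basis_filter:
  "eventually P (basis_filter C x) \<longleftrightarrow> (\<exists>e>0. \<forall>R\<in>C x. diameter R < e \<longrightarrow> P R)"
  unfolding basis_filter_def
proof (subst eventually_INF_base)
  show "\<exists>x\<in>{0<..}. principal {R \<in> C y. diameter R < x}
      \<le> inf (principal {R \<in> C y. diameter R < a}) (principal {R \<in> C y. diameter R < b})"
    if "a \<in> {0<..}" "b \<in> {0<..}" for a b :: real and y
    using that by (intro bexI[of _ "min a b"]) auto
qed (auto simp: eventually_principal intro: exI[of _ 1])

text \<open>One index controls both the smallness of the diameter and the size of the average; this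
  exhibits the set of infinite derivative as a countable intersection.\<close>

lemma upper_deriv_eq_infinity_iff:
  "upper_deriv C f x = \<infinity> \<longleftrightarrow>
    (\<forall>k::nat. \<exists>R\<in>C x. diameter R < inverse (real (Suc k)) \<and> real k < average f R)"
proof
  assume inf: "upper_deriv C f x = \<infinity>"
  show "\<forall>k::nat. \<exists>R\<in>C x. diameter R < inverse (real (Suc k)) \<and> real k < average f R"
  proof
    fix k :: nat
    define P where "P R \<longleftrightarrow> R \<in> C x \<and> diameter R < inverse (real (Suc k))" for R
    have "eventually P (basis_filter C x)"
      unfolding eventually_basis_filter P_def by (intro exI[of _ "inverse (real (Suc k))"]) simp
    then have "upper_deriv C f x \<le> (SUP R\<in>Collect P. ereal (average f R))"
      unfolding upper_deriv_def Limsup_def by (intro INF_lower) simp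
    then have "ereal k < (SUP R\<in>Collect P. ereal (average f R))"
      using inf by simp
    then show "\<exists>R\<in>C x. diameter R < inverse (real (Suc k)) \<and> real k < average f R"
      unfolding less_SUP_iff by (auto simp: P_def)
  qed
next
  assume *: "\<forall>k::nat. \<exists>R\<in>C x. diameter R < inverse (real (Suc k)) \<and> real k < average f R"
  have "\<infinity> \<le> (SUP R\<in>Collect P. ereal (average f R))" if P: "eventually P (basis_filter C x)" for P
  proof -
    obtain e where e: "e > 0" "\<And>R. R \<in> C x \<Longrightarrow> diameter R < e \<Longrightarrow> P R"
      using P unfolding eventually_basis_filter by blast
    obtain m where m: "inverse (real (Suc m)) < e" using reals_Archimedean[OF e(1)] by auto
    have "ereal n \<le> (SUP R\<in>Collect P. ereal (average f R))" for n :: nat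
    proof -
      \<comment> \<open>In the index \<open>max m n\<close>, the part \<open>m\<close> brings the
        diameter below \<open>e\<close> and the part \<open>n\<close> pushes the average above
        \<open>n\<close>.\<close>
      obtain R where R: "R \<in> C x" "diameter R < inverse (real (Suc (max m n)))"
          "real (max m n) < average f R" using * by blast
      have "inverse (real (Suc (max m n))) \<le> inverse (real (Suc m))" by (intro le_imp_inverse_le) auto
      with R m have "diameter R < e" by linarith
      with R have "P R" by (intro e)
      then have "ereal (average f R) \<le> (SUP R\<in>Collect P. ereal (average f R))" by (intro SUP_upper) simp
      moreover have "ereal n \<le> ereal (average f R)" using R(3) by simp
      ultimately show ?thesis by (rule order_trans[rotated])
    qed
    then show ?thesis by (metis SUP_nat_Infty SUP_least)
  qed
  then show "upper_deriv C f x = \<infinity>"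
    unfolding upper_deriv_def Limsup_def by (intro antisym INF_greatest) auto
qed

text \<open>These are the sets \<open>W\<^sub>k(\<gamma>)\<close>, with \<open>\<R>\<close> standing
  for \<open>B 0\<close>. The strict bound on the average is what makes them open.\<close>

definition large_average_set :: "complex set set \<Rightarrow> (complex \<Rightarrow> real) \<Rightarrow> nat \<Rightarrow> complex \<Rightarrow> complex set"
  where "large_average_set \<R> f k \<gamma> = {x. \<exists>R\<in>\<R>. diameter R < inverse (real (Suc k)) \<and>
    real k < average f ((\<lambda>u. x + \<gamma> * u) ` R)}"

lemma large_average_set_antimono:
  "large_average_set \<R> f (Suc k) \<gamma> \<subseteq> large_average_set \<R> f k \<gamma>"
proof -
  have le: "inverse (real (Suc (Suc k))) \<le> inverse (real (Suc k))" by (intro le_imp_inverse_le) auto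
  have "real k < v" "d < inverse (real (Suc k))"
    if "d < inverse (real (Suc (Suc k)))" "real (Suc k) < v" for d v
    using that le by linarith+
  then show ?thesis unfolding large_average_set_def by blast
qed

lemma diameter_rigid_image:
  fixes c x :: complex
  assumes "norm c = 1"
  shows "diameter ((\<lambda>u. x + c * u) ` R) = diameter R"
proof -
  have "dist (x + c * u) (x + c * v) = dist u v" for u v
    using assms by (simp add: dist_norm norm_mult flip: right_diff_distrib)
  then have "(\<lambda>(x, y). dist x y) ` ((\<lambda>u. x + c * u) ` R \<times> (\<lambda>u. x + c * u) ` R) =
      (\<lambda>(x, y). dist x y) ` (R \<times> R)"
    by (force simp: image_iff)
  then show ?thesis by (simp add: diameter_def)
qed

text \<open>Translation invariance enters here: all points and rotations share the family
  \<open>B 0\<close>, so one \<open>R\<close> can be reused at nearby points and rotations.\<close>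

lemma rot_basis_transl_inv:
  assumes "transl_inv B"
  shows "rot_basis B \<gamma> x = (\<lambda>R. (\<lambda>u. x + \<gamma> * u) ` R) ` B 0"
proof -
  have "B x = (\<lambda>R. (\<lambda>y. x + y) ` R) ` B 0" using assms unfolding transl_inv_def by blast
  then show ?thesis by (simp add: rot_basis_def image_image)
qed

lemma upper_deriv_rot_basis_eq_infinity_iff:
  assumes "transl_inv B" "norm \<gamma> = 1"
  shows "upper_deriv (rot_basis B \<gamma>) f x = \<infinity> \<longleftrightarrow> (\<forall>k. x \<in> large_average_set (B 0) f k \<gamma>)"
  unfolding upper_deriv_eq_infinity_iff large_average_set_def rot_basis_transl_inv[OF assms(1)]
  by (simp add: diameter_rigid_image[OF assms(2)])

section \<open>Openness and lower semicontinuity of the large-average sets\<close>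

text \<open>A witness \<open>R\<close> at the limit persists: its average depends continuously on
  point and rotation, and the diameter condition concerns \<open>R\<close> alone. A constant
  rotation yields openness, a constant point yields semicontinuity.\<close>

lemma eventually_large_average_set:
  fixes c :: "nat \<Rightarrow> complex"
  assumes f: "integrable lebesgue f" and \<R>: "\<R> \<subseteq> lmeasurable"
    and c: "\<And>n. norm (c n) = 1" "c \<longlonglongrightarrow> c0" and x: "x \<longlonglongrightarrow> x0"
    and x0: "x0 \<in> large_average_set \<R> f k c0"
  shows "\<forall>\<^sub>F n in sequentially. x n \<in> large_average_set \<R> f k (c n)"
proof -
  have c0: "norm c0 = 1"
    using tendsto_norm[OF c(2)] c(1) by (simp add: LIMSEQ_const_iff)
  obtain R where R: "R \<in> \<R>" "diameter R < inverse (real (Suc k))"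
      "real k < average f ((\<lambda>u. x0 + c0 * u) ` R)"
    using x0 unfolding large_average_set_def by blast
  have Rm: "R \<in> lmeasurable" using R \<R> by auto
  have av: "average f ((\<lambda>u. y + d * u) ` R) = (LINT u:R|lebesgue. f (y + d * u)) / measure lebesgue R"
    if "norm d = 1" for y d
    unfolding average_def using that Rm f by (simp add: set_integral_rigid_image measure_rigid_image)
  have "(\<lambda>n. average f ((\<lambda>u. x n + c n * u) ` R)) \<longlonglongrightarrow> average f ((\<lambda>u. x0 + c0 * u) ` R)"
    unfolding av[OF c0] av[OF c(1)] divide_inverse
    by (intro tendsto_mult_right tendsto_set_integral_rigid_motion c x f Rm)
  from order_tendstoD(1)[OF this R(3)] show ?thesis
    by eventually_elim (use R in \<open>auto simp: large_average_set_def\<close>)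
qed

lemma open_large_average_set:
  assumes f: "integrable lebesgue f" and \<R>: "\<R> \<subseteq> lmeasurable" and c: "norm c = 1"
  shows "open (large_average_set \<R> f k c)"
  unfolding open_closed closed_sequential_limits
proof (intro allI impI, elim conjE)
  fix x l assume x: "\<forall>n. x n \<in> - large_average_set \<R> f k c" "x \<longlonglongrightarrow> l"
  show "l \<in> - large_average_set \<R> f k c"
  proof
    assume "l \<in> large_average_set \<R> f k c"
    from eventually_large_average_set[OF f \<R> c tendsto_const x(2) this] x(1)
    show False by auto
  qed
qed

text \<open>Fatou's lemma, applied to a sequence of rotations converging to \<open>c\<close>.\<close>
lemma measure_large_average_set_lsc:
  assumes f: "integrable lebesgue f" and \<R>: "\<R> \<subseteq> lmeasurable" and c: "norm c = 1"
    and D: "D \<in> lmeasurable" and less: "m < measure lebesgue (large_average_set \<R> f k c \<inter> D)"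
  shows "\<exists>r>0. \<forall>c'. norm c' = 1 \<and> dist c' c < r \<longrightarrow>
    m < measure lebesgue (large_average_set \<R> f k c' \<inter> D)"
proof (rule ccontr)
  let ?W = "\<lambda>c. large_average_set \<R> f k c \<inter> D"
  assume neg: "\<not> ?thesis"
  have "\<exists>c'. norm c' = 1 \<and> dist c' c < inverse (real (Suc n)) \<and> measure lebesgue (?W c') \<le> m" for n
    using neg by (metis inverse_positive_iff_positive not_le of_nat_0_less_iff zero_less_Suc)
  then obtain d where d: "\<And>n. norm (d n) = 1" "\<And>n. dist (d n) c < inverse (real (Suc n))"
      "\<And>n. measure lebesgue (?W (d n)) \<le> m"
    by metis
  have lim: "d \<longlonglongrightarrow> c"
    by (rule metric_tendsto_imp_tendsto[OF LIMSEQ_inverse_real_of_nat])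
       (use d(2) in \<open>auto intro!: always_eventually less_imp_le\<close>)
  have Wm: "?W c \<in> lmeasurable" if "norm c = 1" for c
    using open_large_average_set[OF f \<R> that] D
    by (metis Int_commute fmeasurable_Int_fmeasurable lborelD borel_open sets_completionI_sets sets_lborel)
  \<comment> \<open>The sets \<open>V N\<close> increase to the lower limit of the sets
    \<open>?W (d n)\<close>, and each lies inside \<open>?W (d N)\<close>, whose measure is at most
    \<open>m\<close>.\<close>
  define V where "V N = (\<Inter>n\<in>{N..}. ?W (d n))" for N
  have Vs: "V N \<in> lmeasurable" for N
    unfolding V_def using Wm[OF d(1)] by (intro fmeasurable_INT[of _ N]) auto
  have V_le: "measure lebesgue (V N) \<le> m" for N
    by (rule order_trans[OF measure_mono_fmeasurable d(3)[of N]])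
       (use Vs Wm d in \<open>auto simp: V_def\<close>)
  have U: "(\<Union>N. V N) \<in> lmeasurable"
    proof (rule fmeasurableI2[OF D])
    show "(\<Union>N. V N) \<in> sets lebesgue"
      by (rule sets.countable_UN'') (use Vs in auto)
  qed (auto simp: V_def)
  have "(\<lambda>N. measure lebesgue (V N)) \<longlonglongrightarrow> measure lebesgue (\<Union>N. V N)"
    using Vs U by (intro Lim_measure_incseq) (auto simp: V_def incseq_def fmeasurable_def)
  then have U_le: "measure lebesgue (\<Union>N. V N) \<le> m"
    using V_le by (intro LIMSEQ_le_const2) auto
  \<comment> \<open>With \<open>x\<close> fixed and the rotations converging to \<open>c\<close>,
    membership holds from some index on, so \<open>?W c\<close> lies in the lower limit.\<close>
  have "?W c \<subseteq> (\<Union>N. V N)"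
  proof
    fix x assume x: "x \<in> ?W c"
    from eventually_large_average_set[OF f \<R> d(1) lim tendsto_const, of x] x
    obtain N where "\<forall>n\<ge>N. x \<in> large_average_set \<R> f k (d n)"
      unfolding eventually_sequentially by blast
    with x show "x \<in> (\<Union>N. V N)" by (auto simp: V_def)
  qed
  then have "measure lebesgue (?W c) \<le> measure lebesgue (\<Union>N. V N)"
    using U Wm[OF c] by (intro measure_mono_fmeasurable) auto
  with U_le less show False by linarith
qed

section \<open>The arc metric on the rotation group\<close>

text \<open>The arguments add up to a correction by 2 \<pi>, made only when the sum leaves the
  principal range, and it then reduces the absolute value. This yields the triangle inequality for
  \<open>arcdist\<close>.\<close>

lemma Arg_mult_abs_le:
  assumes "z \<noteq> 0" "w \<noteq> 0"
  shows "\<bar>Arg (z * w)\<bar> \<le> \<bar>Arg z\<bar> + \<bar>Arg w\<bar>"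
  using Arg_times'[OF assms] Arg_bounded[of z] Arg_bounded[of w]
  by (auto split: if_splits)

text \<open>A chord is no longer than its arc: the chord of angle t is 2 |sin(t/2)|, which is at
  most |t|.\<close>

lemma dist_le_arcdist:
  assumes "a \<in> Gamma2" "b \<in> Gamma2"
  shows "dist a b \<le> arcdist a b"
proof -
  have n: "norm a = 1" "norm b = 1" "b \<noteq> 0" using assms by (auto simp: Gamma2_def)
  then have "a / b = cis (Arg (a / b))"
    by (metis cis_Arg div_0 divide_eq_0_iff norm_divide norm_eq_zero sgn_eq zero_neq_one div_by_1 of_real_1)
  then have "dist a b = norm (cis (Arg (a / b)) - 1)"
    using n by (metis diff_divide_distrib dist_norm div_by_1 div_self norm_divide)
  also have "\<dots> \<le> \<bar>Arg (a / b)\<bar>"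
    using dist_exp_i_1[of "Arg (a / b)"] abs_sin_x_le_abs_x[of "Arg (a / b) / 2"] by (simp add: cis_conv_exp)
  finally show ?thesis by (simp add: arcdist_def)
qed

lemma Metric_space_arcdist: "Metric_space Gamma2 arcdist"
proof
  show "0 \<le> arcdist a b" for a b by (simp add: arcdist_def)
  \<comment> \<open>\<open>b / a\<close> is the inverse of \<open>a / b\<close>; inversion negates
    \<open>Arg\<close>, except that the value \<pi> is kept.\<close>
  show "arcdist a b = arcdist b a" for a b
    using Arg_inverse[of "a / b"] by (auto simp: arcdist_def Arg_eq_pi Arg_eq_0)
  show "arcdist a b = 0 \<longleftrightarrow> a = b" if "a \<in> Gamma2" "b \<in> Gamma2" for a b
  proof
    assume "arcdist a b = 0" 
    then show "a = b" using dist_le_arcdist[OF that] by simp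
  qed (use that in \<open>auto simp: arcdist_def Gamma2_def\<close>)
  show "arcdist a c \<le> arcdist a b + arcdist b c" if "a \<in> Gamma2" "b \<in> Gamma2" "c \<in> Gamma2" for a b c
  proof -
    have "a \<noteq> 0" "b \<noteq> 0" "c \<noteq> 0" using that by (auto simp: Gamma2_def)
    then show ?thesis using Arg_mult_abs_le[of "a / b" "b / c"] by (simp add: arcdist_def)
  qed
qed

section \<open>The representation of \<open>E\<close> as a countable intersection of open
  sets\<close>

theorem theorem1:
  fixes B :: "complex \<Rightarrow> complex set set" and E :: "complex set"
  assumes "diff_basis B" and "transl_inv B" and "R_B_set B E"
  shows "gdelta_in (Metric_space.mtopology Gamma2 arcdist) E"
proof -
  interpret M: Metric_space Gamma2 arcdist by (rule Metric_space_arcdist)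
  obtain f where E: "E \<subseteq> Gamma2" and f: "integrable lebesgue f"
    and f1: "\<And>\<gamma>. \<gamma> \<in> E \<Longrightarrow> AE x in lebesgue. upper_deriv (rot_basis B \<gamma>) f x = \<infinity>"
    and f2: "\<And>\<gamma>. \<gamma> \<in> Gamma2 - E \<Longrightarrow> f \<in> F_class (rot_basis B \<gamma>)"
    using assms(3) unfolding R_B_set_def by blast
  have \<R>: "B 0 \<subseteq> lmeasurable"
    using assms(1) unfolding diff_basis_def by (auto intro: bounded_set_imp_lmeasurable)
  \<comment> \<open>Cutting down to a disc makes all measures finite, as continuity from above
    requires.\<close>
  define D :: "complex set" where "D = ball 0 1"
  have D: "D \<in> lmeasurable" "measure lebesgue D > 0"
    unfolding D_def by (auto simp: content_ball_pos)
  define W where "W k \<gamma> = large_average_set (B 0) f k \<gamma>" for k \<gamma>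
  \<comment> \<open>One half may be any fraction strictly between 0 and 1: rotations in
    \<open>E\<close> give the full measure of \<open>D\<close>, all others give measures tending to
    0.\<close>
  define G where "G k = {\<gamma> \<in> Gamma2. measure lebesgue D / 2 < measure lebesgue (W k \<gamma> \<inter> D)}" for k
  have W_iff: "upper_deriv (rot_basis B \<gamma>) f x = \<infinity> \<longleftrightarrow> (\<forall>k. x \<in> W k \<gamma>)" if "\<gamma> \<in> Gamma2" for \<gamma> x
    using upper_deriv_rot_basis_eq_infinity_iff[OF assms(2)] that by (simp add: W_def Gamma2_def)
  have Wopen: "open (W k \<gamma>)" if "\<gamma> \<in> Gamma2" for k \<gamma>
    using that unfolding W_def by (intro open_large_average_set f \<R>) (simp add: Gamma2_def)
  then have Ws: "W k \<gamma> \<inter> D \<in> lmeasurable" if "\<gamma> \<in> Gamma2" for k \<gamma>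
    using that unfolding D_def by (intro lmeasurable_open) auto
  have G_open: "openin M.mtopology (G k)" for k
    unfolding M.openin_mtopology
  proof (intro conjI allI impI)
    fix c assume c: "c \<in> G k"
    then obtain r where r: "r > 0" "\<And>c'. norm c' = 1 \<Longrightarrow> dist c' c < r \<Longrightarrow>
        measure lebesgue D / 2 < measure lebesgue (W k c' \<inter> D)"
      using measure_large_average_set_lsc[OF f \<R> _ D(1)] unfolding G_def W_def Gamma2_def by blast
    \<comment> \<open>The radius \<open>r\<close> refers to chordal distance; since chords are at
      most arcs, the arc ball of the same radius fits.\<close>
    have "M.mball c r \<subseteq> G k"
    proof
      fix c' assume "c' \<in> M.mball c r"
      then have c': "c \<in> Gamma2" "c' \<in> Gamma2" "arcdist c c' < r" by auto
      then have "dist c' c < r" using dist_le_arcdist[of c c'] by (simp add: dist_commute)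
      with c' show "c' \<in> G k"
        using r(2)[of c'] by (simp add: G_def Gamma2_def)
    qed
    with r(1) show "\<exists>r>0. M.mball c r \<subseteq> G k" by blast
  qed (auto simp: G_def)
  have "E = (\<Inter>k. G k)"
  proof (intro equalityI subsetI)
    fix \<gamma> assume \<gamma>: "\<gamma> \<in> E"
    then have \<gamma>': "\<gamma> \<in> Gamma2" using E by auto
    \<comment> \<open>Almost every point has infinite upper derivative and so lies in every
      \<open>W k \<gamma>\<close>.\<close>
    have "measure lebesgue (W k \<gamma> \<inter> D) = measure lebesgue D" for k
    proof (rule measure_eq_AE)
      show "AE x in lebesgue. x \<in> W k \<gamma> \<inter> D \<longleftrightarrow> x \<in> D"
        using f1[OF \<gamma>] by eventually_elim (use W_iff[OF \<gamma>'] in auto)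
    qed (use Ws[OF \<gamma>'] D in auto)
    then show "\<gamma> \<in> (\<Inter>k. G k)" using \<gamma>' D(2) by (simp add: G_def)
  next
    fix \<gamma> assume \<gamma>: "\<gamma> \<in> (\<Inter>k. G k)"
    then have \<gamma>': "\<gamma> \<in> Gamma2" by (simp add: G_def)
    show "\<gamma> \<in> E"
    proof (rule ccontr)
      assume "\<gamma> \<notin> E"
      then have "AE x in lebesgue. upper_deriv (rot_basis B \<gamma>) f x = ereal (f x)"
        using f2[of \<gamma>] \<gamma>' unfolding F_class_def by auto
      \<comment> \<open>A point in all \<open>W k \<gamma>\<close> has infinite upper derivative,
        whereas almost everywhere the derivative is the finite value \<open>f x\<close>.\<close>
      then have "AE x in lebesgue. x \<in> (\<Inter>k. W k \<gamma> \<inter> D) \<longleftrightarrow> x \<in> {}"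
        by eventually_elim
          (metis (no_types, lifting) INT_iff Int_iff PInfty_neq_ereal(1) UNIV_I W_iff[OF \<gamma>'] empty_iff)
      moreover have "(\<Inter>k. W k \<gamma> \<inter> D) \<in> sets lebesgue"
        by (rule sets.countable_INT'') (use Ws[OF \<gamma>'] in auto)
      ultimately have "measure lebesgue (\<Inter>k. W k \<gamma> \<inter> D) = measure lebesgue ({} :: complex set)"
        by (rule measure_eq_AE) simp
      moreover have "(\<lambda>k. measure lebesgue (W k \<gamma> \<inter> D)) \<longlonglongrightarrow> measure lebesgue (\<Inter>k. W k \<gamma> \<inter> D)"
      proof (rule Lim_measure_decseq)
        show "decseq (\<lambda>k. W k \<gamma> \<inter> D)"
          unfolding W_def by (intro decseq_SucI Int_mono large_average_set_antimono order_refl)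
        show "emeasure lebesgue (W k \<gamma> \<inter> D) \<noteq> \<infinity>" for k
          using Ws[OF \<gamma>', of k] by (auto simp: fmeasurable_def)
      qed (use Ws[OF \<gamma>'] in auto)
      \<comment> \<open>The bound survives the limit in weak form, and a positive lower bound still
        contradicts the limit 0.\<close>
      moreover have "measure lebesgue D / 2 \<le> measure lebesgue (W k \<gamma> \<inter> D)" for k
        using \<gamma> by (auto simp: G_def less_imp_le)
      ultimately have "measure lebesgue D / 2 \<le> measure lebesgue ({} :: complex set)"
        by (intro LIMSEQ_le_const) auto
      then show False using D(2) by simp
    qed
  qed
  also have "gdelta_in M.mtopology (\<Inter>k. G k)"
    by (intro gdelta_in_Inter) (auto intro: open_imp_gdelta_in G_open)
  finally show ?thesis .
qed

end
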